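(* Let $n\ge1$, let $S_n$ be a real irreducible left $C\ell_n$-module with Clifford map $c:\mathbb{R}^n\to\mathrm{End}_{\mathbb{R}}(S_n)$, with right $\mathbb{K}_n$- and $\mathbb{K}^0_n$-actions and spin metric $g_{S_n}$ as in the context. Let $\Phi:S_n\to S_n$ be an $\mathbb{R}$-linear isometry of $(S_n,g_{S_n})$ that is right $\mathbb{K}_n^0$-linear and for which there is $\phi\in SO(n)$ such that $$\Phi(c(v)s)=c(\phi(v))\,\Phi(s)\quad\text{for all }v\in\mathbb{R}^n,\ s\in S_n.$$ Then $\Phi$ is the left action on $S_n$ of an element of $Spin(n)\subset C\ell_n$. Conversely the left action of every element of $Spin(n)$ on $S_n$ has these properties. That is, $$P_{Spin}(\mathbb{R}^n,g_n,S_n)=Spin(n).$$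
   Context: $C\ell_n$ is the unital real Clifford algebra of Euclidean $\mathbb{R}^n$ with $v\cdot w+w\cdot v=-2\langle v,w\rangle$. $C\ell_n^0$ is its even subalgebra. $Pin(n)$ is the group generated by unit vectors of $\mathbb{R}^n$ inside the invertible elements of $C\ell_n$, and $Spin(n)=Pin(n)\cap C\ell_n^0$. $\mathbb{K}_n$ and $\mathbb{K}_n^0\supseteq\mathbb{K}_n$ are the algebras of $\mathbb{R}$-linear endomorphisms of $S_n$ commuting with $C\ell_n$, respectively with $C\ell_n^0$, acting on $S_n$ on the right (via the opposite algebras); $\mathbb{K}_n$ is isomorphic to $\mathbb{R}$, $\mathbb{C}$ or $\mathbb{H}$, and $\mathrm{Im}\,\mathbb{K}_n$ is its imaginary part. A spin metric $g_{S_n}$ is a real inner product on $S_n$ for which $c(v)$ is skew-adjoint for all $v\in\mathbb{R}^n$ and right multiplication by every $a\in\mathrm{Im}\,\mathbb{K}_n$ is skew-adjoint. $P_{Spin}(\mathbb{R}^n,g_n,S_n)$ denotes the set of all linear isometries $\Phi$ of $(S_n,g_{S_n})$ that are right $\mathbb{K}_n^0$-linear and for which there is a unique $\phi\in SO(n)$ satisfying the displayed relation. *)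

theory Defs
  imports "HOL-Analysis.Analysis"
begin

section \<open>The Clifford algebra of Euclidean space\<close>

text \<open>
  The Clifford algebra of \<^typ>\<open>real ^ 'n\<close> is the unital associative real algebra presented by the
  generators \<open>v \<in> \<real>\<^sup>n\<close>, linear in \<open>v\<close>, and the relations \<open>v w + w v = - 2 \<langle>v, w\<rangle>\<close>: terms modulo
  the least congruence that contains the algebra axioms and these relations.  The theorem
  \<open>cl_universal\<close> below is its universal property.
\<close>

datatype 'n cl_term =
    Const real
  | Vec "real ^ 'n"
  | Add "'n cl_term" "'n cl_term"
  | Mul "'n cl_term" "'n cl_term"

inductive cl_rel :: "'n::finite cl_term \<Rightarrow> 'n cl_term \<Rightarrow> bool" where
  refl: "cl_rel x x"
| sym: "cl_rel x y \<Longrightarrow> cl_rel y x"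
| trans: "cl_rel x y \<Longrightarrow> cl_rel y z \<Longrightarrow> cl_rel x z"
| add_cong: "cl_rel x x' \<Longrightarrow> cl_rel y y' \<Longrightarrow> cl_rel (Add x y) (Add x' y')"
| mul_cong: "cl_rel x x' \<Longrightarrow> cl_rel y y' \<Longrightarrow> cl_rel (Mul x y) (Mul x' y')"
| add_assoc: "cl_rel (Add (Add x y) z) (Add x (Add y z))"
| add_comm: "cl_rel (Add x y) (Add y x)"
| add_zero: "cl_rel (Add (Const 0) x) x"
| add_neg: "cl_rel (Add (Mul (Const (-1)) x) x) (Const 0)"
| mul_assoc: "cl_rel (Mul (Mul x y) z) (Mul x (Mul y z))"
| mul_one: "cl_rel (Mul (Const 1) x) x"
| distrib_l: "cl_rel (Mul x (Add y z)) (Add (Mul x y) (Mul x z))"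
| distrib_r: "cl_rel (Mul (Add x y) z) (Add (Mul x z) (Mul y z))"
| const_central: "cl_rel (Mul x (Const r)) (Mul (Const r) x)"
| const_add: "cl_rel (Const (r + s)) (Add (Const r) (Const s))"
| const_mul: "cl_rel (Const (r * s)) (Mul (Const r) (Const s))"
| vec_add: "cl_rel (Vec (v + w)) (Add (Vec v) (Vec w))"
| vec_scale: "cl_rel (Vec (r *\<^sub>R v)) (Mul (Const r) (Vec v))"
| clifford: "cl_rel (Add (Mul (Vec v) (Vec w)) (Mul (Vec w) (Vec v))) (Const (- 2 * (v \<bullet> w)))"

quotient_type (overloaded) 'n cl = "'n::finite cl_term" / cl_rel
  by (rule equivpI) (auto intro: reflpI sympI transpI cl_rel.refl cl_rel.sym cl_rel.trans)

lift_definition cl_vec :: "real ^ 'n \<Rightarrow> 'n::finite cl" is Vec .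

text \<open>
  The algebra is not the zero ring: it acts on the functions on subsets of an enumerated index set.
\<close>

definition flip :: "'n \<Rightarrow> 'n set \<Rightarrow> 'n set" where
  "flip i A = (if i \<in> A then A - {i} else insert i A)"

definition cl_sign :: "('n \<Rightarrow> nat) \<Rightarrow> 'n \<Rightarrow> 'n set \<Rightarrow> real" where
  "cl_sign r i A = (if i \<in> A then 1 else - 1) * (- 1) ^ card {j \<in> A. r j < r i}"

primrec cl_model :: "('n::finite \<Rightarrow> nat) \<Rightarrow> 'n cl_term \<Rightarrow> ('n set \<Rightarrow> real) \<Rightarrow> 'n set \<Rightarrow> real" where
  "cl_model r (Const c) = (\<lambda>f A. c * f A)"
| "cl_model r (Vec v) = (\<lambda>f A. \<Sum>i\<in>UNIV. v $ i * (cl_sign r i A * f (flip i A)))"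
| "cl_model r (Add x y) = (\<lambda>f A. cl_model r x f A + cl_model r y f A)"
| "cl_model r (Mul x y) = (\<lambda>f. cl_model r x (cl_model r y f))"

lemma cl_model_add: "cl_model r x (\<lambda>A. f A + g A) = (\<lambda>A. cl_model r x f A + cl_model r x g A)"
  by (induction x arbitrary: f g) (auto simp: algebra_simps sum.distrib)

lemma cl_model_scale: "cl_model r x (\<lambda>A. c * f A) = (\<lambda>A. c * cl_model r x f A)"
  by (induction x arbitrary: f) (auto simp: algebra_simps sum_distrib_left)

lemma flip_commute: "flip i (flip j A) = flip j (flip i A)"
  by (auto simp: flip_def)

lemma flip_same: "flip i (flip i A) = A"
  by (auto simp: flip_def)

lemma cl_sign_square: "cl_sign r i A * cl_sign r i (flip i A) = - 1"
proof -
  have "{j \<in> flip i A. r j < r i} = {j \<in> A. r j < r i}"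
    by (auto simp: flip_def)
  then show ?thesis
    by (auto simp: cl_sign_def flip_def power_mult_distrib[symmetric])
qed

lemma cl_sign_flip_greater:
  assumes "r i < r j" shows "cl_sign r i (flip j A) = cl_sign r i A"
proof -
  have "{k \<in> flip j A. r k < r i} = {k \<in> A. r k < r i}" "i \<in> flip j A \<longleftrightarrow> i \<in> A"
    using assms by (auto simp: flip_def)
  then show ?thesis by (simp add: cl_sign_def)
qed

lemma cl_sign_flip_less:
  fixes A :: "'n::finite set"
  assumes "r i < r j" shows "cl_sign r j (flip i A) = - cl_sign r j A"
proof -
  have ij: "j \<in> flip i A \<longleftrightarrow> j \<in> A"
    using assms by (auto simp: flip_def)
  have "(- 1 :: real) ^ card {k \<in> flip i A. r k < r j} = - ((- 1) ^ card {k \<in> A. r k < r j})"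
  proof (cases "i \<in> A")
    case True
    let ?B = "{k \<in> flip i A. r k < r j}"
    have "{k \<in> A. r k < r j} = insert i ?B" "i \<notin> ?B"
      using True assms by (auto simp: flip_def)
    then have "card {k \<in> A. r k < r j} = Suc (card ?B)" by simp
    then show ?thesis by simp
  next
    case False
    let ?B = "{k \<in> A. r k < r j}"
    have "{k \<in> flip i A. r k < r j} = insert i ?B" "i \<notin> ?B"
      using False assms by (auto simp: flip_def)
    then have "card {k \<in> flip i A. r k < r j} = Suc (card ?B)" by simp
    then show ?thesis by simp
  qed
  with ij show ?thesis by (simp add: cl_sign_def)
qed

lemma cl_sign_anticommute:
  fixes r :: "'n::finite \<Rightarrow> nat"
  assumes "inj r"
  shows "cl_sign r i A * cl_sign r j (flip i A) + cl_sign r j A * cl_sign r i (flip j A)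
    = (if i = j then - 2 else 0)"
proof (cases "i = j")
  case False
  then have "r i < r j \<or> r j < r i"
    using assms by (meson injD linorder_neqE_nat)
  then show ?thesis
    using False by (auto simp: cl_sign_flip_greater cl_sign_flip_less)
qed (simp add: cl_sign_square)

lemma cl_model_clifford:
  fixes v w :: "real ^ 'n::finite"
  assumes "inj r"
  shows "cl_model r (Add (Mul (Vec v) (Vec w)) (Mul (Vec w) (Vec v))) f A = - 2 * (v \<bullet> w) * f A"
proof -
  let ?s = "cl_sign r"
  have "cl_model r (Add (Mul (Vec v) (Vec w)) (Mul (Vec w) (Vec v))) f A
    = (\<Sum>i\<in>UNIV. \<Sum>j\<in>UNIV. v $ i * w $ j * (?s i A * ?s j (flip i A)) * f (flip j (flip i A)))
      + (\<Sum>j\<in>UNIV. \<Sum>i\<in>UNIV. v $ i * w $ j * (?s j A * ?s i (flip j A)) * f (flip i (flip j A)))"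
    by (simp add: sum_distrib_left mult_ac)
  also have "(\<Sum>j\<in>UNIV. \<Sum>i\<in>UNIV. v $ i * w $ j * (?s j A * ?s i (flip j A)) * f (flip i (flip j A)))
    = (\<Sum>i\<in>UNIV. \<Sum>j\<in>UNIV. v $ i * w $ j * (?s j A * ?s i (flip j A)) * f (flip j (flip i A)))"
    by (subst sum.swap) (simp add: flip_commute)
  also have "(\<Sum>i\<in>UNIV. \<Sum>j\<in>UNIV. v $ i * w $ j * (?s i A * ?s j (flip i A)) * f (flip j (flip i A))) + \<dots>
    = (\<Sum>i\<in>UNIV. \<Sum>j\<in>UNIV. v $ i * w $ j *
        (?s i A * ?s j (flip i A) + ?s j A * ?s i (flip j A)) * f (flip j (flip i A)))"
    by (simp add: sum.distrib algebra_simps)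
  also have "\<dots> = (\<Sum>i\<in>UNIV. \<Sum>j\<in>UNIV. if i = j then - 2 * (v $ i * w $ i) * f A else 0)"
    by (intro sum.cong refl) (auto simp: cl_sign_anticommute[OF assms] flip_same)
  also have "\<dots> = - 2 * (v \<bullet> w) * f A"
    by (simp add: inner_vec_def sum_distrib_left sum_distrib_right)
  finally show ?thesis .
qed

lemma cl_model_rel: "cl_rel x y \<Longrightarrow> inj r \<Longrightarrow> cl_model r x = cl_model r y"
proof (induction rule: cl_rel.induct)
  case (clifford v w)
  show ?case
    by (intro ext) (use cl_model_clifford[OF clifford, of v w] in simp)
qed (auto simp: cl_model_add cl_model_scale algebra_simps sum.distrib sum_distrib_left intro!: ext)

lemma cl_nontrivial: "\<not> cl_rel (Const 0) (Const 1 :: 'n::finite cl_term)"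
proof
  assume *: "cl_rel (Const 0) (Const 1 :: 'n cl_term)"
  obtain r :: "'n \<Rightarrow> nat" where "inj r"
    using finite_imp_inj_to_nat_seg[of "UNIV :: 'n set"] by auto
  from fun_cong[OF fun_cong[OF cl_model_rel[OF * this], of "\<lambda>_. 1"], of "{}"] show False
    by simp
qed

instantiation cl :: (finite) real_algebra_1
begin

lift_definition zero_cl :: "'a cl" is "Const 0" .
lift_definition one_cl :: "'a cl" is "Const 1" .
lift_definition plus_cl :: "'a cl \<Rightarrow> 'a cl \<Rightarrow> 'a cl" is Add by (rule cl_rel.add_cong)
lift_definition times_cl :: "'a cl \<Rightarrow> 'a cl \<Rightarrow> 'a cl" is Mul by (rule cl_rel.mul_cong)
lift_definition scaleR_cl :: "real \<Rightarrow> 'a cl \<Rightarrow> 'a cl" is "\<lambda>r. Mul (Const r)"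
  by (auto intro: cl_rel.intros)
definition uminus_cl :: "'a cl \<Rightarrow> 'a cl" where "uminus_cl x = (- 1) *\<^sub>R x"
definition minus_cl :: "'a cl \<Rightarrow> 'a cl \<Rightarrow> 'a cl" where "minus_cl x y = x + (- y :: 'a cl)"

instance
proof
  fix x y z :: "'a cl" and r s :: real
  show "x + y + z = x + (y + z)" by transfer (rule cl_rel.add_assoc)
  show "x + y = y + x" by transfer (rule cl_rel.add_comm)
  show "0 + x = x" by transfer (rule cl_rel.add_zero)
  show "- x + x = 0" unfolding uminus_cl_def by transfer (rule cl_rel.add_neg)
  show "x - y = x + - y" by (simp add: minus_cl_def)
  show "x * y * z = x * (y * z)" by transfer (rule cl_rel.mul_assoc)
  show "1 * x = x" by transfer (rule cl_rel.mul_one)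
  show "x * 1 = x" by transfer (meson cl_rel.trans cl_rel.const_central cl_rel.mul_one)
  show "(x + y) * z = x * z + y * z" by transfer (rule cl_rel.distrib_r)
  show "x * (y + z) = x * y + x * z" by transfer (rule cl_rel.distrib_l)
  show "(0 :: 'a cl) \<noteq> 1" by transfer (rule cl_nontrivial)
  show "r *\<^sub>R (x + y) = r *\<^sub>R x + r *\<^sub>R y" by transfer (rule cl_rel.distrib_l)
  show "(r + s) *\<^sub>R x = r *\<^sub>R x + s *\<^sub>R x"
    by transfer (meson cl_rel.trans cl_rel.const_add cl_rel.distrib_r cl_rel.mul_cong cl_rel.refl)
  show "r *\<^sub>R s *\<^sub>R x = (r * s) *\<^sub>R x"
    by transfer
      (meson cl_rel.trans cl_rel.sym cl_rel.const_mul cl_rel.mul_assoc cl_rel.mul_cong cl_rel.refl)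
  show "1 *\<^sub>R x = x" by transfer (rule cl_rel.mul_one)
  show "r *\<^sub>R x * y = r *\<^sub>R (x * y)" by transfer (rule cl_rel.mul_assoc)
  show "x * r *\<^sub>R y = r *\<^sub>R (x * y)"
    by transfer
      (meson cl_rel.trans cl_rel.sym cl_rel.const_central cl_rel.mul_assoc cl_rel.mul_cong cl_rel.refl)
qed

end

lemma linear_cl_vec: "linear cl_vec"
proof (rule linearI)
  show "cl_vec (v + w) = cl_vec v + cl_vec w" for v w :: "real ^ 'a"
    by transfer (rule cl_rel.vec_add)
  show "cl_vec (r *\<^sub>R v) = r *\<^sub>R cl_vec v" for r and v :: "real ^ 'a"
    by transfer (rule cl_rel.vec_scale)
qed

lemma cl_vec_clifford: "cl_vec v * cl_vec w + cl_vec w * cl_vec v = (- 2 * (v \<bullet> w)) *\<^sub>R 1"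
  by transfer
    (meson cl_rel.trans cl_rel.sym cl_rel.clifford cl_rel.mul_one cl_rel.const_central)

lemma cl_induct:
  fixes x :: "'n::finite cl"
  assumes "\<And>r. P (r *\<^sub>R 1)" and "\<And>v. P (cl_vec v)"
    and "\<And>x y. P x \<Longrightarrow> P y \<Longrightarrow> P (x + y)" and "\<And>x y. P x \<Longrightarrow> P y \<Longrightarrow> P (x * y)"
  shows "P x"
proof -
  have const: "abs_cl (Const r) = r *\<^sub>R (1 :: 'n cl)" for r
    by transfer (meson cl_rel.trans cl_rel.sym cl_rel.mul_one cl_rel.const_central)
  have "P (abs_cl t)" for t
    by (induction t)
      (use assms in \<open>auto simp: const plus_cl.abs_eq[symmetric] times_cl.abs_eq[symmetric]
        cl_vec.abs_eq[symmetric]\<close>)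
  then show ?thesis by (rule cl.abs_induct)
qed

primrec cl_eval :: "(real ^ 'n \<Rightarrow> 'a::real_algebra_1) \<Rightarrow> 'n::finite cl_term \<Rightarrow> 'a" where
  "cl_eval f (Const r) = r *\<^sub>R 1"
| "cl_eval f (Vec v) = f v"
| "cl_eval f (Add x y) = cl_eval f x + cl_eval f y"
| "cl_eval f (Mul x y) = cl_eval f x * cl_eval f y"

theorem cl_universal:
  fixes f :: "real ^ 'n::finite \<Rightarrow> 'a::real_algebra_1"
  assumes "linear f" and "\<And>v w. f v * f w + f w * f v = (- 2 * (v \<bullet> w)) *\<^sub>R 1"
  shows "\<exists>!F. linear F \<and> F 1 = 1 \<and> (\<forall>x y. F (x * y) = F x * F y) \<and> (\<forall>v. F (cl_vec v) = f v)"
proof (rule ex_ex1I)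
  have "cl_eval f x = cl_eval f y" if "cl_rel x y" for x y
    using that
    by induction (use assms in \<open>auto simp: algebra_simps linear_add linear_scale\<close>)
  then have eval: "cl_eval f (rep_cl (abs_cl t)) = cl_eval f t" for t
    using Quotient3_rep_abs[OF Quotient3_cl] cl_rel.refl by metis
  define F where "F x = cl_eval f (rep_cl x)" for x
  have F: "F (abs_cl t) = cl_eval f t" for t
    by (simp add: F_def eval)
  have "F (x + y) = F x + F y \<and> F (x * y) = F x * F y" for x y
    by (induction x rule: cl.abs_induct, induction y rule: cl.abs_induct)
      (simp add: plus_cl.abs_eq times_cl.abs_eq F)
  moreover have "F (r *\<^sub>R x) = r *\<^sub>R F x" for r x
    by (induction x rule: cl.abs_induct) (simp add: scaleR_cl.abs_eq F)
  moreover have "F 1 = 1" "F (cl_vec v) = f v" for v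
    by (simp_all add: cl_vec.abs_eq one_cl_def F)
  ultimately show "\<exists>F. linear F \<and> F 1 = 1 \<and> (\<forall>x y. F (x * y) = F x * F y) \<and> (\<forall>v. F (cl_vec v) = f v)"
    by (intro exI[of _ F]) (auto intro: linearI)
next
  fix F G
  assume F: "linear F \<and> F 1 = 1 \<and> (\<forall>x y. F (x * y) = F x * F y) \<and> (\<forall>v. F (cl_vec v) = f v)"
    and G: "linear G \<and> G 1 = 1 \<and> (\<forall>x y. G (x * y) = G x * G y) \<and> (\<forall>v. G (cl_vec v) = f v)"
  show "F = G"
  proof
    show "F x = G x" for x
      by (induction x rule: cl_induct) (use F G in \<open>auto simp: linear_add linear_scale\<close>)
  qed
qed

definition cl_even :: "'n::finite cl set" where
  "cl_even = span {prod_list (map cl_vec vs) | vs. even (length vs)}"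

inductive_set cl_pin :: "'n::finite cl set" where
  one: "1 \<in> cl_pin"
| unit: "norm v = 1 \<Longrightarrow> cl_vec v \<in> cl_pin"
| mult: "x \<in> cl_pin \<Longrightarrow> y \<in> cl_pin \<Longrightarrow> x * y \<in> cl_pin"
| inv: "x \<in> cl_pin \<Longrightarrow> x * y = 1 \<Longrightarrow> y * x = 1 \<Longrightarrow> y \<in> cl_pin"

definition cl_spin :: "'n::finite cl set" where
  "cl_spin = cl_pin \<inter> cl_even"

definition special_orthogonal :: "(real ^ 'n \<Rightarrow> real ^ 'n::finite) set" where
  "special_orthogonal = {\<phi>. orthogonal_transformation \<phi> \<and> det (matrix \<phi>) = 1}"


section \<open>Quaternions\<close>

datatype quat = Quat (qRe: real) (qI: real) (qJ: real) (qK: real)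

instantiation quat :: real_algebra_1
begin

definition zero_quat :: quat where "zero_quat = Quat 0 0 0 0"
definition one_quat :: quat where "one_quat = Quat 1 0 0 0"
definition plus_quat :: "quat \<Rightarrow> quat \<Rightarrow> quat" where
  "plus_quat x y = Quat (qRe x + qRe y) (qI x + qI y) (qJ x + qJ y) (qK x + qK y)"
definition uminus_quat :: "quat \<Rightarrow> quat" where
  "uminus_quat x = Quat (- qRe x) (- qI x) (- qJ x) (- qK x)"
definition minus_quat :: "quat \<Rightarrow> quat \<Rightarrow> quat" where
  "minus_quat x y = Quat (qRe x - qRe y) (qI x - qI y) (qJ x - qJ y) (qK x - qK y)"
definition scaleR_quat :: "real \<Rightarrow> quat \<Rightarrow> quat" where
  "scaleR_quat r x = Quat (r * qRe x) (r * qI x) (r * qJ x) (r * qK x)"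
definition times_quat :: "quat \<Rightarrow> quat \<Rightarrow> quat" where
  "times_quat x y = Quat
     (qRe x * qRe y - qI x * qI y - qJ x * qJ y - qK x * qK y)
     (qRe x * qI y + qI x * qRe y + qJ x * qK y - qK x * qJ y)
     (qRe x * qJ y - qI x * qK y + qJ x * qRe y + qK x * qI y)
     (qRe x * qK y + qI x * qJ y - qJ x * qI y + qK x * qRe y)"

instance
  by standard
    (simp_all add: zero_quat_def one_quat_def plus_quat_def uminus_quat_def minus_quat_def
      scaleR_quat_def times_quat_def algebra_simps)

end


section \<open>Clifford modules, commutants and spin metrics\<close>

text \<open>A left module structure is given by its action map \<open>act x s = x \<cdot> s\<close>.\<close>

definition left_cl_module :: "('n::finite cl \<Rightarrow> 's::real_vector \<Rightarrow> 's) \<Rightarrow> bool" where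
  "left_cl_module act \<longleftrightarrow>
     bilinear act \<and> (\<forall>s. act 1 s = s) \<and> (\<forall>x y s. act (x * y) s = act x (act y s))"

definition irreducible_cl_module :: "('n::finite cl \<Rightarrow> 's::real_vector \<Rightarrow> 's) \<Rightarrow> bool" where
  "irreducible_cl_module act \<longleftrightarrow>
     left_cl_module act \<and> (\<exists>s::'s. s \<noteq> 0) \<and>
     (\<forall>U. subspace U \<and> (\<forall>x. \<forall>s\<in>U. act x s \<in> U) \<longrightarrow> U = {0} \<or> U = UNIV)"

definition clifford_map :: "('n::finite cl \<Rightarrow> 's \<Rightarrow> 's) \<Rightarrow> real ^ 'n \<Rightarrow> 's \<Rightarrow> 's" where
  "clifford_map act v = act (cl_vec v)"

definition cl_commutant ::
    "('n::finite cl \<Rightarrow> 's::real_vector \<Rightarrow> 's) \<Rightarrow> 'n cl set \<Rightarrow> ('s \<Rightarrow> 's) set" where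
  "cl_commutant act X = {a. linear a \<and> (\<forall>x\<in>X. \<forall>s. a (act x s) = act x (a s))}"

definition KK :: "('n::finite cl \<Rightarrow> 's::real_vector \<Rightarrow> 's) \<Rightarrow> ('s \<Rightarrow> 's) set" where
  "KK act = cl_commutant act UNIV"

definition KK0 :: "('n::finite cl \<Rightarrow> 's::real_vector \<Rightarrow> 's) \<Rightarrow> ('s \<Rightarrow> 's) set" where
  "KK0 act = cl_commutant act cl_even"

text \<open>
  The right action of an endomorphism, \<open>s \<cdot> a = a s\<close>; it is a right action for the opposite
  product \<open>opp_prod\<close>.
\<close>

definition right_act :: "'s \<Rightarrow> ('s \<Rightarrow> 's) \<Rightarrow> 's" where
  "right_act s a = a s"

definition opp_prod :: "('s \<Rightarrow> 's) \<Rightarrow> ('s \<Rightarrow> 's) \<Rightarrow> 's \<Rightarrow> 's" where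
  "opp_prod a b = b \<circ> a"

lemma right_act_opp_prod: "right_act s (opp_prod a b) = right_act (right_act s a) b"
  by (simp add: right_act_def opp_prod_def)

definition opp_algebra_iso ::
    "('s::real_vector \<Rightarrow> 's) set \<Rightarrow> (('s \<Rightarrow> 's) \<Rightarrow> 'k::real_algebra_1) \<Rightarrow> bool" where
  "opp_algebra_iso K F \<longleftrightarrow>
     bij_betw F K UNIV \<and> F id = 1 \<and>
     (\<forall>a\<in>K. \<forall>b\<in>K. F (\<lambda>s. a s + b s) = F a + F b \<and> F (opp_prod a b) = F a * F b) \<and>
     (\<forall>r. \<forall>a\<in>K. F (\<lambda>s. r *\<^sub>R a s) = r *\<^sub>R F a)"

text \<open>
  The imaginary part of an algebra isomorphic to the reals, the complex numbers or the
  quaternions.  All isomorphisms give the same subset, since automorphisms of these algebras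
  preserve the real part.
\<close>

definition imaginary_part :: "('s::real_vector \<Rightarrow> 's) set \<Rightarrow> ('s \<Rightarrow> 's) set" where
  "imaginary_part K = {a \<in> K.
     (\<exists>F :: ('s \<Rightarrow> 's) \<Rightarrow> real. opp_algebra_iso K F \<and> F a = 0) \<or>
     (\<exists>F :: ('s \<Rightarrow> 's) \<Rightarrow> complex. opp_algebra_iso K F \<and> Re (F a) = 0) \<or>
     (\<exists>F :: ('s \<Rightarrow> 's) \<Rightarrow> quat. opp_algebra_iso K F \<and> qRe (F a) = 0)}"

definition real_inner_product :: "('s::real_vector \<Rightarrow> 's \<Rightarrow> real) \<Rightarrow> bool" where
  "real_inner_product g \<longleftrightarrow>
     bilinear g \<and> (\<forall>s t. g s t = g t s) \<and> (\<forall>s. s \<noteq> 0 \<longrightarrow> 0 < g s s)"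

definition skew_adjoint :: "('s \<Rightarrow> 's \<Rightarrow> real) \<Rightarrow> ('s \<Rightarrow> 's) \<Rightarrow> bool" where
  "skew_adjoint g T \<longleftrightarrow> (\<forall>s t. g (T s) t = - g s (T t))"

definition spin_metric ::
    "('n::finite cl \<Rightarrow> 's::real_vector \<Rightarrow> 's) \<Rightarrow> ('s \<Rightarrow> 's \<Rightarrow> real) \<Rightarrow> bool" where
  "spin_metric act g \<longleftrightarrow>
     real_inner_product g \<and>
     (\<forall>v. skew_adjoint g (clifford_map act v)) \<and>
     (\<forall>a\<in>imaginary_part (KK act). skew_adjoint g (\<lambda>s. right_act s a))"

definition linear_isometry :: "('s::real_vector \<Rightarrow> 's \<Rightarrow> real) \<Rightarrow> ('s \<Rightarrow> 's) \<Rightarrow> bool" where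
  "linear_isometry g \<Phi> \<longleftrightarrow> linear \<Phi> \<and> (\<forall>s t. g (\<Phi> s) (\<Phi> t) = g s t)"

definition right_linear_over :: "('s::real_vector \<Rightarrow> 's) set \<Rightarrow> ('s \<Rightarrow> 's) \<Rightarrow> bool" where
  "right_linear_over K \<Phi> \<longleftrightarrow>
     (\<forall>s t. \<Phi> (s + t) = \<Phi> s + \<Phi> t) \<and> (\<forall>a\<in>K. \<forall>s. \<Phi> (right_act s a) = right_act (\<Phi> s) a)"

definition clifford_covers ::
    "('n::finite cl \<Rightarrow> 's \<Rightarrow> 's) \<Rightarrow> ('s \<Rightarrow> 's) \<Rightarrow> (real ^ 'n \<Rightarrow> real ^ 'n) \<Rightarrow> bool" where
  "clifford_covers act \<Phi> \<phi> \<longleftrightarrow>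
     (\<forall>v s. \<Phi> (clifford_map act v s) = clifford_map act (\<phi> v) (\<Phi> s))"

definition P_Spin ::
    "('n::finite cl \<Rightarrow> 's::real_vector \<Rightarrow> 's) \<Rightarrow> ('s \<Rightarrow> 's \<Rightarrow> real) \<Rightarrow> ('s \<Rightarrow> 's) set" where
  "P_Spin act g = {\<Phi>. linear_isometry g \<Phi> \<and> right_linear_over (KK0 act) \<Phi> \<and>
     (\<exists>!\<phi>. \<phi> \<in> special_orthogonal \<and> clifford_covers act \<Phi> \<phi>)}"

end

theory Submission
  imports Defs
begin

text \<open>
  Suppose that \<open>\<Phi>\<close> covers the rotation \<open>\<phi>\<close>.  By Cartan and Dieudonne, \<open>\<phi>\<close> is a product of an even
  number of reflections (\<open>cartan_dieudonne\<close>); multiplying the corresponding unit vectors gives an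
  element \<open>x\<close> of the spin group that covers \<open>\<phi>\<close> as well (\<open>special_orthogonal_lift\<close>).  Hence
  \<open>\<Psi> = x\<^sup>-\<^sup>1 \<Phi>\<close> commutes with every \<open>c(v)\<close>, and still commutes with \<open>\<K>\<^sup>0\<close>, because \<open>x\<^sup>-\<^sup>1\<close> is even.
  If such a map is necessarily a real scalar, then it is \<open>\<plusminus> 1\<close>, being an isometry, and
  \<open>\<Phi> = \<plusminus> x\<close> lies in the spin group.

  That scalar property (\<open>commutant_scalar\<close>) is the heart of the proof.  It could be read off from the
  classification of Clifford algebras and the double commutant theorem; the argument here is
  uniform in the dimension.  It shows that \<open>\<K>\<^sup>0\<close> and the Clifford action together generate
  all linear endomorphisms of \<open>S\<close>.  Conjugations by the actions of the basis vectors \<open>e\<^sub>i\<close> are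
  commuting involutions of \<open>End(S)\<close>, so every \<open>T\<close> is a sum of maps that commute or
  anticommute with each single \<open>e\<^sub>i\<close> (\<open>commutes_with_all_linear\<close>).  Multiplying such a map by
  suitable \<open>e\<^sub>j\<close> makes all these signs equal, and a map with a uniform sign commutes with all even
  products, that is, lies in \<open>\<K>\<^sup>0\<close> (\<open>sign_commutes_commute\<close>).  So \<open>\<Psi>\<close> commutes with all
  of \<open>End(S)\<close> and is scalar.

  For injectivity, an element of the spin group acting as the identity covers the identity
  rotation, so it is even and central in the Clifford algebra.  The scalar property, applied to
  the Clifford algebra as a left module over itself, says that such an element is a real number
  (\<open>even_central_imp_scalar\<close>), and this number is \<open>1\<close>.
\<close>

section \<open>Left Clifford modules\<close>

lemma cl_module_simps:
  assumes "left_cl_module act"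
  shows "act 1 s = s" and "act (x * y) s = act x (act y s)"
    and "act x (s + t) = act x s + act x t" and "act (x + y) s = act x s + act y s"
    and "act (r *\<^sub>R x) s = r *\<^sub>R act x s" and "act x (r *\<^sub>R s) = r *\<^sub>R act x s"
    and "act (- x) s = - act x s" and "act x (- s) = - act x s"
    and "act x 0 = 0" and "act 0 s = 0"
    and "act x (s - t) = act x s - act x t" and "act (x - y) s = act x s - act y s"
    and "linear (act x)"
  using assms
  by (auto simp: left_cl_module_def bilinear_def linear_add linear_scale linear_neg linear_0
      linear_diff linear_add[of "\<lambda>x. act x s"] linear_scale[of "\<lambda>x. act x s"]
      linear_neg[of "\<lambda>x. act x s"] linear_diff[of "\<lambda>x. act x s"] linear_0[of "\<lambda>x. act x s"])

abbreviation cl_gen :: "'n \<Rightarrow> 'n::finite cl" where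
  "cl_gen i \<equiv> cl_vec (axis i 1)"

lemma cl_vec_square: "cl_vec v * cl_vec v = - (v \<bullet> v) *\<^sub>R 1"
proof -
  have "2 *\<^sub>R (cl_vec v * cl_vec v) = 2 *\<^sub>R (- (v \<bullet> v) *\<^sub>R 1)"
    using cl_vec_clifford[of v v] by (simp add: scaleR_2[symmetric])
  then show ?thesis by (metis scaleR_cancel_left zero_neq_numeral)
qed

lemma cl_vec_unit_square: "norm u = 1 \<Longrightarrow> cl_vec u * cl_vec u = - 1"
  by (simp add: cl_vec_square norm_eq_1)

lemma cl_gen_square: "cl_gen i * cl_gen i = - 1"
  by (simp add: cl_vec_unit_square)

lemma cl_gen_anticommute: "i \<noteq> j \<Longrightarrow> cl_gen i * cl_gen j = - (cl_gen j * cl_gen i)"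
  using cl_vec_clifford[of "axis i 1" "axis j 1"]
  by (simp add: inner_axis_axis eq_neg_iff_add_eq_0)

lemma cl_vec_eq_sum: "cl_vec v = (\<Sum>i\<in>UNIV. (v $ i) *\<^sub>R cl_gen i)"
proof -
  have "v = (\<Sum>i\<in>UNIV. (v $ i) *\<^sub>R axis i 1)"
    by (simp add: basis_expansion scalar_mult_eq_scaleR[symmetric])
  then have "cl_vec v = cl_vec (\<Sum>i\<in>UNIV. (v $ i) *\<^sub>R axis i 1)" by simp
  also have "\<dots> = (\<Sum>i\<in>UNIV. (v $ i) *\<^sub>R cl_gen i)"
    by (simp add: linear_sum[OF linear_cl_vec] linear_scale[OF linear_cl_vec])
  finally show ?thesis .
qed


section \<open>The endomorphisms commuting with the module and its even commutant\<close>

definition sign_commutes ::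
    "('n::finite cl \<Rightarrow> 's::real_vector \<Rightarrow> 's) \<Rightarrow> ('n \<Rightarrow> real) \<Rightarrow> 'n \<Rightarrow> ('s \<Rightarrow> 's) \<Rightarrow> bool" where
  "sign_commutes act \<sigma> i T \<longleftrightarrow> (\<forall>s. act (cl_gen i) (T s) = \<sigma> i *\<^sub>R T (act (cl_gen i) s))"

text \<open>
  The sign \<open>\<epsilon>\<close> extends from the basis to all vectors by linearity, and an even product of vectors
  picks it up an even number of times.
\<close>

lemma KK0_I_uniform_sign:
  assumes M: "left_cl_module act" and T: "linear T" and \<epsilon>: "\<epsilon> \<in> {1, - 1 :: real}"
    and comm: "\<And>i. sign_commutes act (\<lambda>_. \<epsilon>) i T"
  shows "T \<in> KK0 act"
proof -
  note ms = cl_module_simps[OF M]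
  have vec: "act (cl_vec v) (T s) = \<epsilon> *\<^sub>R T (act (cl_vec v) s)" for v s
  proof -
    have L: "linear (\<lambda>x. act x t)" for t
      using ms by (intro linearI) auto
    show ?thesis
      using comm unfolding sign_commutes_def
      by (simp add: cl_vec_eq_sum[of v] linear_sum[OF L] ms linear_sum[OF T] linear_scale[OF T]
          scaleR_sum_right mult.commute)
  qed
  have prod: "act (prod_list (map cl_vec vs)) (T s)
      = \<epsilon> ^ length vs *\<^sub>R T (act (prod_list (map cl_vec vs)) s)" for vs s
    by (induction vs) (simp_all add: ms vec mult.commute)
  have "T (act x s) = act x (T s)" if "x \<in> cl_even" for x s
    using that unfolding cl_even_def
  proof (induction x rule: span_induct_alt)
    case base
    then show ?case using T by (simp add: ms linear_0)
  next
    case (step c x y)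
    then have "T (act x s) = act x (T s)"
      using prod \<epsilon> by auto
    then show ?case
      using step T by (simp add: ms linear_add linear_scale)
  qed
  with T show ?thesis by (simp add: KK0_def cl_commutant_def)
qed

text \<open>
  Composing \<open>T\<close> with the action of \<open>e\<^sub>j\<close> changes its sign at every index other than \<open>j\<close>.  Measured against the
  opposite sign \<open>- \<epsilon>\<close>, this repairs the index \<open>j\<close> and leaves the status of the others as it
  was, so that the number of exceptional indices drops until the sign is uniform.  Since \<open>e\<^sub>j\<close>
  acts invertibly and commutes with \<open>\<Psi>\<close>, nothing is lost on the way.
\<close>

lemma sign_commutes_commute:
  assumes M: "left_cl_module act" and \<Psi>: "linear \<Psi>"
    and vec: "\<And>v s. \<Psi> (act (cl_vec v) s) = act (cl_vec v) (\<Psi> s)"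
    and K0: "\<And>a s. a \<in> KK0 act \<Longrightarrow> \<Psi> (a s) = a (\<Psi> s)"
    and T: "linear T" and \<epsilon>: "\<epsilon> \<in> {1, - 1 :: real}" and \<sigma>: "\<And>i. \<sigma> i \<in> {1, - 1 :: real}"
    and comm: "\<And>i. sign_commutes act \<sigma> i T"
  shows "\<Psi> (T s) = T (\<Psi> s)"
  using T \<epsilon> \<sigma> comm
proof (induction "card {i. \<sigma> i \<noteq> \<epsilon>}" arbitrary: \<sigma> \<epsilon> T s)
  case 0
  then have "\<sigma> = (\<lambda>_. \<epsilon>)" by (auto simp: fun_eq_iff)
  with 0 have "T \<in> KK0 act"
    by (intro KK0_I_uniform_sign[OF M]) auto
  then show ?case by (rule K0)
next
  case (Suc k)
  note ms = cl_module_simps[OF M]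
  from Suc.hyps(2) obtain j where j: "\<sigma> j \<noteq> \<epsilon>"
    by (metis (mono_tags, lifting) card.empty empty_Collect_eq nat.distinct(1))
  define T' where "T' s = T (act (cl_gen j) s)" for s
  define \<sigma>' where "\<sigma>' i = (if i = j then \<sigma> i else - \<sigma> i)" for i
  have "{i. \<sigma>' i \<noteq> - \<epsilon>} = {i. \<sigma> i \<noteq> \<epsilon>} - {j}"
    using j Suc.prems(2,3) unfolding \<sigma>'_def by force
  then have "k = card {i. \<sigma>' i \<noteq> - \<epsilon>}"
    using j Suc.hyps(2) by simp
  moreover have "linear T'"
    unfolding T'_def using linear_compose[OF ms(13) \<open>linear T\<close>] by (simp add: o_def)
  moreover have "- \<epsilon> \<in> {1, - 1}" using Suc.prems(2) by auto
  moreover have "\<sigma>' i \<in> {1, - 1}" for i using Suc.prems(3)[of i] by (auto simp: \<sigma>'_def)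
  moreover have "sign_commutes act \<sigma>' i T'" for i
  proof (cases "i = j")
    case True
    then show ?thesis using Suc.prems(4)[of j]
      by (simp add: sign_commutes_def T'_def \<sigma>'_def)
  next
    case False
    have "act (cl_gen i) (act (cl_gen j) s) = - act (cl_gen j) (act (cl_gen i) s)" for s
      by (simp add: ms(2)[symmetric] cl_gen_anticommute[OF False] ms(7))
    then show ?thesis using Suc.prems(4)[of i] False \<open>linear T\<close>
      by (simp add: sign_commutes_def T'_def \<sigma>'_def linear_neg)
  qed
  ultimately have *: "\<Psi> (T' s) = T' (\<Psi> s)" for s
    by (rule Suc.hyps(1))
  have inv: "act (cl_gen j) (act (cl_gen j) s) = - s" for s
    by (simp add: ms(2)[symmetric] cl_gen_square ms)
  have "\<Psi> (T' (act (cl_gen j) s)) = - \<Psi> (T s)" "T' (\<Psi> (act (cl_gen j) s)) = - T (\<Psi> s)"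
    using \<Psi> \<open>linear T\<close> by (simp_all add: T'_def vec inv linear_neg)
  with *[of "act (cl_gen j) s"] show ?case by simp
qed

text \<open>
  As \<open>e\<^sub>j\<^sup>-\<^sup>1 = - e\<^sub>j\<close>, conjugation by \<open>e\<^sub>j\<close> is the involution \<open>T \<mapsto> - e\<^sub>j T e\<^sub>j\<close>, and \<open>T\<close> is the sum of its
  two eigencomponents \<open>(T \<plusminus> (- e\<^sub>j T e\<^sub>j)) / 2\<close>.  Conjugations by different basis vectors commute, so splitting
  along \<open>e\<^sub>j\<close> preserves the signs already achieved elsewhere; hence the induction over the set
  of indices at which \<open>T\<close> need not have a sign yet.
\<close>

lemma commutes_with_all_linear:
  assumes M: "left_cl_module act" and \<Psi>: "linear \<Psi>"
    and vec: "\<And>v s. \<Psi> (act (cl_vec v) s) = act (cl_vec v) (\<Psi> s)"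
    and K0: "\<And>a s. a \<in> KK0 act \<Longrightarrow> \<Psi> (a s) = a (\<Psi> s)"
    and T: "linear T"
  shows "\<Psi> (T s) = T (\<Psi> s)"
proof -
  note ms = cl_module_simps[OF M]
  have "\<Psi> (T s) = T (\<Psi> s)"
    if "finite I" "linear T" "\<And>i. \<sigma> i \<in> {1, - 1 :: real}" "\<And>i. i \<notin> I \<Longrightarrow> sign_commutes act \<sigma> i T"
    for I \<sigma> T s
    using that
  proof (induction I arbitrary: \<sigma> T s)
    case empty
    then show ?case
      by (intro sign_commutes_commute[OF M \<Psi> vec K0, of _ 1 \<sigma>]) auto
  next
    case (insert j I)
    \<comment> \<open>\<open>C\<close> is the conjugate of \<open>T\<close> by \<open>e\<^sub>j\<close>, and \<open>T' e\<close> the component with sign \<open>e\<close> at \<open>j\<close>.\<close>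
    define C where "C s = - act (cl_gen j) (T (act (cl_gen j) s))" for s
    define T' where "T' e s = (1/2) *\<^sub>R (T s + e *\<^sub>R C s)" for e s
    have inv: "act (cl_gen j) (act (cl_gen j) s) = - s" for s
      by (simp add: ms(2)[symmetric] cl_gen_square ms)
    have linC: "linear C"
      unfolding C_def using \<open>linear T\<close> by (intro linearI) (simp_all add: ms linear_add linear_scale)
    have part: "\<Psi> (T' e s) = T' e (\<Psi> s)" if e: "e \<in> {1, - 1}" for e s
    proof (rule insert.IH)
      show "linear (T' e)"
        unfolding T'_def using \<open>linear T\<close> linC
        by (intro linearI) (simp_all add: linear_add linear_scale algebra_simps)
      show "(\<sigma>(j := e)) i \<in> {1, - 1}" for i
        using insert.prems(2) e by auto
      show "sign_commutes act (\<sigma>(j := e)) i (T' e)" if "i \<notin> I" for i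
      proof (cases "i = j")
        case True
        have "e * e = 1" using e by auto
        then show ?thesis
          using True \<open>linear T\<close>
          by (simp add: sign_commutes_def T'_def C_def ms inv linear_neg scaleR_add_right add.commute
              scaleR_left_commute[of e])
      next
        case False
        have anti: "act (cl_gen i) (act (cl_gen j) s) = - act (cl_gen j) (act (cl_gen i) s)" for s
          by (simp add: ms(2)[symmetric] cl_gen_anticommute[OF False] ms(7))
        have T: "act (cl_gen i) (T s) = \<sigma> i *\<^sub>R T (act (cl_gen i) s)" for s
          using insert.prems(3)[of i] False that by (simp add: sign_commutes_def)
        have "act (cl_gen i) (C s) = \<sigma> i *\<^sub>R C (act (cl_gen i) s)" for s
          using \<open>linear T\<close> by (simp add: C_def ms anti T linear_neg)
        with T show ?thesis
          using False by (simp add: sign_commutes_def T'_def ms scaleR_add_right scaleR_left_commute)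
      qed
    qed
    have split: "T s = T' 1 s + T' (- 1) s" for s
      by (simp add: T'_def scaleR_add_right[symmetric] scaleR_2[symmetric] flip: scaleR_add_left)
    show ?case
      unfolding split using part by (simp add: linear_add[OF \<Psi>])
  qed
  \<comment> \<open>With every index in the exceptional set, any choice of \<open>\<sigma>\<close> will do.\<close>
  from this[of UNIV T "\<lambda>_. 1" s] T show ?thesis by simp
qed

lemma commutes_with_all_linear_imp_scalar:
  fixes \<Psi> :: "'s::real_vector \<Rightarrow> 's"
  assumes \<Psi>: "linear \<Psi>" and comm: "\<And>T s. linear T \<Longrightarrow> \<Psi> (T s) = T (\<Psi> s)"
  shows "\<exists>c. \<forall>s. \<Psi> s = c *\<^sub>R s"
proof (cases "\<forall>s::'s. s = 0")
  case True
  then show ?thesis by (metis)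
next
  case False
  then obtain s0 :: 's where s0: "s0 \<noteq> 0" by blast
  \<comment> \<open>Otherwise some linear \<open>T\<close> kills \<open>s0\<close> and fixes \<open>\<Psi> s0\<close>.\<close>
  have "\<Psi> s0 \<in> span {s0}"
  proof (rule ccontr)
    assume *: "\<Psi> s0 \<notin> span {s0}"
    then have ne: "\<Psi> s0 \<noteq> s0" by (metis span_base singletonI)
    have "independent {\<Psi> s0, s0}"
      using * s0 by (simp add: independent_insert dependent_single)
    from linear_independent_extend[OF this, of "\<lambda>x. if x = s0 then 0 else x"]
    obtain T where T: "linear T" "T s0 = 0" "T (\<Psi> s0) = \<Psi> s0" using ne by auto
    then have "\<Psi> s0 = 0" using comm[of T s0] linear_0[OF \<Psi>] by simp
    with * show False by (simp add: span_zero)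
  qed
  then obtain c where c: "\<Psi> s0 = c *\<^sub>R s0"
    by (auto simp: span_singleton)
  have "\<Psi> s = c *\<^sub>R s" for s
  proof -
    have "independent {s0}" using s0 by (simp add: dependent_single)
    from linear_independent_extend[OF this, of "\<lambda>_. s"]
    obtain T where T: "linear T" "T s0 = s" by auto
    with comm[OF T(1), of s0] show ?thesis by (simp add: c linear_scale)
  qed
  then show ?thesis by blast
qed

text \<open>
  In terms of \<open>\<K>\<close>: only real scalars of \<open>\<K>\<close> commute with all of \<open>\<K>\<^sup>0\<close>.  This holds even if \<open>\<K>\<close> is
  the field of complex numbers, since \<open>\<K>\<^sup>0\<close> then contains conjugate-linear maps.
\<close>

theorem commutant_scalar:
  assumes M: "left_cl_module act" and \<Psi>: "linear \<Psi>"
    and vec: "\<And>v s. \<Psi> (act (cl_vec v) s) = act (cl_vec v) (\<Psi> s)"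
    and K0: "\<And>a s. a \<in> KK0 act \<Longrightarrow> \<Psi> (a s) = a (\<Psi> s)"
  shows "\<exists>c. \<forall>s. \<Psi> s = c *\<^sub>R s"
  using commutes_with_all_linear_imp_scalar[OF \<Psi> commutes_with_all_linear[OF M \<Psi> vec K0]] by blast

text \<open>
  Left multiplication by an even element commutes with the even commutant of the left regular
  module by definition; centrality is commutation with the Clifford action.
\<close>

lemma even_central_imp_scalar:
  fixes z :: "'n::finite cl"
  assumes even: "z \<in> cl_even" and central: "\<And>v. z * cl_vec v = cl_vec v * z"
  obtains c where "z = c *\<^sub>R 1"
proof -
  have lin: "linear ((*) x)" "linear (\<lambda>x. x * y)" for x y :: "'n cl"
    by (auto intro!: linearI simp: algebra_simps)
  have M: "left_cl_module ((*) :: 'n cl \<Rightarrow> _)"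
    using lin by (simp add: left_cl_module_def bilinear_def mult.assoc)
  have "\<exists>c. \<forall>s. z * s = c *\<^sub>R s"
  proof (rule commutant_scalar[OF M lin(1)[of z]])
    show "z * (cl_vec v * s) = cl_vec v * (z * s)" for v s
      by (simp add: mult.assoc[symmetric] central)
    show "z * a s = a (z * s)" if "a \<in> KK0 (*)" for a s
      using that even by (simp add: KK0_def cl_commutant_def)
  qed
  then obtain c where "\<forall>s. z * s = c *\<^sub>R s" ..
  then have "z * 1 = c *\<^sub>R 1" ..
  then show ?thesis by (intro that[of c]) simp
qed


section \<open>Reflections\<close>

definition reflection :: "real ^ 'n \<Rightarrow> real ^ 'n \<Rightarrow> real ^ 'n::finite" where
  "reflection u v = v - (2 * (u \<bullet> v)) *\<^sub>R u"

lemma linear_reflection: "linear (reflection u)"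
  by (rule linearI) (simp_all add: reflection_def inner_add_right algebra_simps)

lemma orthogonal_transformation_reflection:
  assumes "norm u = 1" shows "orthogonal_transformation (reflection u)"
proof -
  have "u \<bullet> u = 1" using assms by (simp add: norm_eq_1)
  then have "reflection u v \<bullet> reflection u w = v \<bullet> w" for v w
    by (simp add: reflection_def inner_diff_left inner_diff_right inner_commute)
  then show ?thesis by (simp add: orthogonal_transformation_def linear_reflection)
qed

lemma reflection_reflection: "norm u = 1 \<Longrightarrow> reflection u (reflection u v) = v"
  by (simp add: reflection_def inner_diff_right norm_eq_1 algebra_simps)

lemma det_reflection_axis: "det (matrix (reflection (axis k 1 :: real ^ 'n::finite))) = - 1"
proof -
  let ?A = "matrix (reflection (axis k 1 :: real ^ 'n))"
  have entries: "?A $ i $ j = (if i = j then if i = k then - 1 else 1 else 0)" for i j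
    by (simp add: matrix_def reflection_def inner_axis_axis) (auto simp: axis_def)
  have "det ?A = (\<Prod>i\<in>UNIV. ?A $ i $ i)"
    by (rule det_diagonal) (simp add: entries)
  also have "\<dots> = - 1"
    by (simp add: entries prod.delta)
  finally show ?thesis .
qed

text \<open>
  Conjugating by an orthogonal map that takes a coordinate vector to \<open>u\<close> reduces to the diagonal
  matrix of a coordinate reflection.
\<close>

lemma det_reflection:
  fixes u :: "real ^ 'n::finite"
  assumes u: "norm u = 1" shows "det (matrix (reflection u)) = - 1"
proof -
  fix k :: 'n
  have "norm (axis k 1 :: real ^ 'n) = norm u" using u by simp
  then obtain f where f: "orthogonal_transformation f" "f (axis k (1::real)) = u"
    by (rule orthogonal_transformation_exists)
  note linf = orthogonal_transformation_linear[OF f(1)]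
  have "reflection u \<circ> f = f \<circ> reflection (axis k 1)"
    using f by (auto simp: fun_eq_iff reflection_def linear_diff linear_scale
        orthogonal_transformation_def)
  then have "matrix (reflection u) ** matrix f = matrix f ** matrix (reflection (axis k 1))"
    by (simp add: linear_reflection linf flip: matrix_compose)
  then have "det (matrix (reflection u)) * det (matrix f) = - det (matrix f)"
    by (metis det_mul det_reflection_axis mult.right_neutral mult_minus_right)
  moreover have "det (matrix f) \<noteq> 0"
    using orthogonal_transformation_det[OF f(1)] by auto
  ultimately show ?thesis
    by (metis mult_cancel_right mult_minus1)
qed

lemma foldr_reflection:
  fixes us :: "(real ^ 'n::finite) list"
  assumes "\<forall>u\<in>set us. norm u = 1"
  shows "orthogonal_transformation (foldr reflection us)"
    and "det (matrix (foldr reflection us)) = (- 1) ^ length us"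
proof -
  have "orthogonal_transformation (foldr reflection us) \<and>
      det (matrix (foldr reflection us)) = (- 1) ^ length us"
    using assms
  proof (induction us)
    case Nil
    then show ?case by (simp add: matrix_id_mat_1[unfolded id_def] id_def)
  next
    case (Cons u us)
    then have IH: "orthogonal_transformation (foldr reflection us)"
      "det (matrix (foldr reflection us)) = (- 1) ^ length us" and u: "norm u = 1"
      by simp_all
    have "matrix (foldr reflection (u # us)) = matrix (reflection u) ** matrix (foldr reflection us)"
      using orthogonal_transformation_linear[OF IH(1)]
      by (simp add: matrix_compose linear_reflection)
    moreover have "orthogonal_transformation (foldr reflection (u # us))"
      using orthogonal_transformation_compose[OF orthogonal_transformation_reflection[OF u] IH(1)]
      by simp
    ultimately show ?case
      by (simp only: det_mul det_reflection[OF u] IH list.size power_Suc) simp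
  qed
  then show "orthogonal_transformation (foldr reflection us)"
    and "det (matrix (foldr reflection us)) = (- 1) ^ length us" by auto
qed

text \<open>
  If \<open>\<phi> v \<noteq> v\<close>, the reflection along \<open>d = \<phi> v - v\<close> takes \<open>\<phi> v\<close> back to \<open>v\<close>, and it fixes every fixed
  vector \<open>w\<close> of \<open>\<phi>\<close>, because \<open>\<langle>\<phi> v, w\<rangle> = \<langle>\<phi> v, \<phi> w\<rangle> = \<langle>v, w\<rangle>\<close>.  So composing with it strictly enlarges
  the fixed space.
\<close>

theorem cartan_dieudonne:
  fixes \<phi> :: "real ^ 'n::finite \<Rightarrow> real ^ 'n"
  assumes "orthogonal_transformation \<phi>"
  shows "\<exists>us. (\<forall>u\<in>set us. norm u = 1) \<and> \<phi> = foldr reflection us"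
  using assms
proof (induction "CARD('n) - dim {v. \<phi> v = v}" arbitrary: \<phi> rule: less_induct)
  case less
  show ?case
  proof (cases "\<forall>v. \<phi> v = v")
    case True
    then show ?thesis by (intro exI[of _ "[]"]) auto
  next
    case False
    then obtain v where v: "\<phi> v \<noteq> v" by blast
    define d where "d = \<phi> v - v"
    define u where "u = d /\<^sub>R norm d"
    have d: "d \<noteq> 0" using v by (simp add: d_def)
    then have u: "norm u = 1" by (simp add: u_def)
    have refl: "reflection u w = w - (2 * (d \<bullet> w) / (d \<bullet> d)) *\<^sub>R d" for w
      using d by (simp add: reflection_def u_def power2_eq_square field_simps flip: power2_norm_eq_inner)
    have iso: "\<phi> x \<bullet> \<phi> y = x \<bullet> y" for x y
      using less.prems by (simp add: orthogonal_transformation_def)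
    define \<psi> where "\<psi> = reflection u \<circ> \<phi>"
    have orth: "orthogonal_transformation \<psi>"
      unfolding \<psi>_def
      by (intro orthogonal_transformation_compose orthogonal_transformation_reflection u less.prems)
    have "\<psi> v = v"
    proof -
      have "2 * (d \<bullet> \<phi> v) = d \<bullet> d"
        by (simp add: d_def inner_diff_left inner_diff_right iso inner_commute)
      then show ?thesis using d by (simp add: \<psi>_def refl) (simp add: d_def)
    qed
    moreover have "\<psi> w = w" if "\<phi> w = w" for w
    proof -
      have "d \<bullet> w = 0"
        using iso[of v w] that by (simp add: d_def inner_diff_left)
      then show ?thesis using that by (simp add: \<psi>_def refl)
    qed
    ultimately have "{v. \<phi> v = v} \<subset> {v. \<psi> v = v}" using v by auto
    moreover have "subspace {v. f v = v}" if "orthogonal_transformation f" for f :: "real ^ 'n \<Rightarrow> _"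
      using orthogonal_transformation_linear[OF that]
      by (auto simp: subspace_def linear_0 linear_add linear_scale)
    ultimately have "dim {v. \<phi> v = v} < dim {v. \<psi> v = v}"
      using orth less.prems by (intro dim_psubset) (simp add: span_eq_iff[THEN iffD2])
    moreover have "dim {v. \<psi> v = v} \<le> CARD('n)"
      using dim_subset_UNIV[of "{v. \<psi> v = v}"] by simp
    ultimately have "CARD('n) - dim {v. \<psi> v = v} < CARD('n) - dim {v. \<phi> v = v}"
      by linarith
    from less.hyps[OF this orth]
    obtain us where us: "\<forall>u\<in>set us. norm u = 1" "\<psi> = foldr reflection us" by blast
    have "\<phi> = foldr reflection (u # us)"
      unfolding foldr.simps us(2)[symmetric] \<psi>_def
      by (simp add: fun_eq_iff reflection_reflection[OF u])
    moreover have "\<forall>w\<in>set (u # us). norm w = 1" using us(1) u by simp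
    ultimately show ?thesis by blast
  qed
qed


section \<open>The spin group and its covering of the rotations\<close>

abbreviation vec_prod :: "(real ^ 'n) list \<Rightarrow> 'n::finite cl" where
  "vec_prod us \<equiv> prod_list (map cl_vec us)"

lemma vec_prod_inverse:
  assumes "\<forall>u\<in>set us. norm u = 1"
  shows "\<exists>ws. (\<forall>w\<in>set ws. norm w = 1) \<and> length ws = length us \<and>
    vec_prod us * vec_prod ws = 1 \<and> vec_prod ws * vec_prod us = 1"
  using assms
proof (induction us)
  case Nil
  then show ?case by (intro exI[of _ "[]"]) auto
next
  case (Cons u us)
  then obtain ws where ws: "\<forall>w\<in>set ws. norm w = 1" "length ws = length us"
    "vec_prod us * vec_prod ws = 1" "vec_prod ws * vec_prod us = 1" by auto
  have neg: "cl_vec (- u) = - cl_vec u" by (rule linear_neg[OF linear_cl_vec])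
  have sq: "cl_vec u * cl_vec u = - 1" using Cons.prems by (simp add: cl_vec_unit_square)
  have "vec_prod (u # us) * vec_prod (ws @ [- u]) = cl_vec u * (vec_prod us * vec_prod ws) * - cl_vec u"
    by (simp add: neg mult.assoc)
  moreover have "vec_prod (ws @ [- u]) * vec_prod (u # us)
      = - (vec_prod ws * (cl_vec u * cl_vec u) * vec_prod us)"
    by (simp add: neg mult.assoc)
  ultimately show ?case
    using ws Cons.prems sq by (intro exI[of _ "ws @ [- u]"]) auto
qed

text \<open>
  The inverses of the pin group come for free: the inverse of a unit vector \<open>u\<close> is the unit
  vector \<open>- u\<close>.
\<close>

lemma cl_pin_iff: "x \<in> cl_pin \<longleftrightarrow> (\<exists>us. (\<forall>u\<in>set us. norm u = 1) \<and> x = vec_prod us)"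
proof
  assume "x \<in> cl_pin"
  then show "\<exists>us. (\<forall>u\<in>set us. norm u = 1) \<and> x = vec_prod us"
  proof induction
    case one
    show ?case by (intro exI[of _ "[]"]) auto
  next
    case (unit v)
    then show ?case by (intro exI[of _ "[v]"]) auto
  next
    case (mult x y)
    then obtain us ws where "\<forall>u\<in>set us. norm u = 1" "x = vec_prod us"
      "\<forall>u\<in>set ws. norm u = 1" "y = vec_prod ws" by auto
    then show ?case by (intro exI[of _ "us @ ws"]) auto
  next
    case (inv x y)
    then obtain us where us: "\<forall>u\<in>set us. norm u = 1" "x = vec_prod us" by auto
    from vec_prod_inverse[OF us(1)] obtain ws
      where ws: "\<forall>w\<in>set ws. norm w = 1" "x * vec_prod ws = 1" using us(2) by auto
    have "y = y * (x * vec_prod ws)" using ws by simp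
    also have "\<dots> = vec_prod ws" using inv.hyps by (simp flip: mult.assoc)
    finally show ?case using ws by auto
  qed
next
  assume "\<exists>us. (\<forall>u\<in>set us. norm u = 1) \<and> x = vec_prod us"
  then obtain us where "\<forall>u\<in>set us. norm u = 1" "x = vec_prod us" by blast
  then show "x \<in> cl_pin"
    by (induction us arbitrary: x) (auto intro: cl_pin.intros)
qed

text \<open>
  That an odd product is not even as well is detected by the parity automorphism \<open>\<alpha>\<close>, the
  extension of \<open>v \<mapsto> - v\<close> given by the universal property: it fixes even elements, negates
  odd products, and products of unit vectors are not \<open>0\<close>.
\<close>

lemma vec_prod_even_iff:
  fixes us :: "(real ^ 'n::finite) list"
  assumes us: "\<forall>u\<in>set us. norm u = 1"
  shows "vec_prod us \<in> cl_even \<longleftrightarrow> even (length us)"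
proof
  assume "even (length us)"
  then show "vec_prod us \<in> cl_even"
    unfolding cl_even_def by (intro span_base) auto
next
  assume ev: "vec_prod us \<in> cl_even"
  let ?f = "\<lambda>v::real ^ 'n. - cl_vec v"
  have "linear ?f" using linear_cl_vec by (rule linear_compose_neg)
  moreover have "?f v * ?f w + ?f w * ?f v = (- 2 * (v \<bullet> w)) *\<^sub>R 1" for v w
    using cl_vec_clifford[of v w] by simp
  ultimately have "\<exists>!\<alpha> :: 'n cl \<Rightarrow> 'n cl. linear \<alpha> \<and> \<alpha> 1 = 1 \<and> (\<forall>x y. \<alpha> (x * y) = \<alpha> x * \<alpha> y) \<and>
      (\<forall>v. \<alpha> (cl_vec v) = ?f v)"
    by (rule cl_universal)
  then obtain \<alpha> :: "'n cl \<Rightarrow> 'n cl" where \<alpha>: "linear \<alpha>" "\<alpha> 1 = 1" "\<And>x y. \<alpha> (x * y) = \<alpha> x * \<alpha> y"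
    "\<And>v. \<alpha> (cl_vec v) = - cl_vec v"
    by auto
  have prod: "\<alpha> (vec_prod vs) = (- 1) ^ length vs *\<^sub>R vec_prod vs" for vs
    by (induction vs) (simp_all add: \<alpha>)
  have "\<alpha> x = x" if "x \<in> cl_even" for x
    using that unfolding cl_even_def
  proof (induction x rule: span_induct_alt)
    case base
    then show ?case using \<alpha>(1) by (rule linear_0)
  next
    case (step c x y)
    then have "\<alpha> x = x" using prod by auto
    with step show ?case using \<alpha>(1) by (simp add: linear_add linear_scale)
  qed
  then have *: "(- 1) ^ length us *\<^sub>R vec_prod us = vec_prod us"
    using ev prod by metis
  have "vec_prod us \<noteq> 0"
    using vec_prod_inverse[OF us] by (metis mult_zero_left zero_neq_one)
  with * show "even (length us)"
    by (metis scaleR_cancel_right scaleR_one neg_one_odd_power one_neq_neg_one)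
qed

lemma cl_spin_iff:
  "x \<in> cl_spin \<longleftrightarrow> (\<exists>us. (\<forall>u\<in>set us. norm u = 1) \<and> even (length us) \<and> x = vec_prod us)"
  using vec_prod_even_iff by (auto simp: cl_spin_def cl_pin_iff)

lemma cl_spin_inverse:
  assumes "x \<in> cl_spin"
  obtains y where "y \<in> cl_spin" "x * y = 1" "y * x = 1"
proof -
  from assms obtain us where us: "\<forall>u\<in>set us. norm u = 1" "even (length us)" "x = vec_prod us"
    unfolding cl_spin_iff by blast
  from vec_prod_inverse[OF us(1)] obtain ws
    where ws: "\<forall>w\<in>set ws. norm w = 1" "length ws = length us"
      "vec_prod us * vec_prod ws = 1" "vec_prod ws * vec_prod us = 1" by blast
  have "vec_prod ws \<in> cl_spin"
    using ws(1,2) us(2) unfolding cl_spin_iff by metis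
  then show ?thesis using ws(3,4) us(3) that by blast
qed

lemma cl_spin_mult: "x \<in> cl_spin \<Longrightarrow> y \<in> cl_spin \<Longrightarrow> x * y \<in> cl_spin"
  unfolding cl_spin_iff
proof (elim exE conjE)
  fix us ws assume "\<forall>u\<in>set us. norm u = 1" "even (length us)" "x = vec_prod us"
    "\<forall>u\<in>set ws. norm u = 1" "even (length ws)" "y = vec_prod ws"
  then show "\<exists>us. (\<forall>u\<in>set us. norm u = 1) \<and> even (length us) \<and> x * y = vec_prod us"
    by (intro exI[of _ "us @ ws"]) auto
qed

lemma minus_one_in_cl_spin: "- 1 \<in> (cl_spin :: 'n::finite cl set)"
  unfolding cl_spin_iff
  by (intro exI[of _ "[axis undefined 1, axis undefined 1]"]) (simp add: cl_gen_square)

lemma cl_vec_reflection: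
  assumes "norm u = 1"
  shows "cl_vec u * cl_vec v = - (cl_vec (reflection u v) * cl_vec u)"
proof -
  have "cl_vec (reflection u v) * cl_vec u
      = cl_vec v * cl_vec u - (2 * (u \<bullet> v)) *\<^sub>R (cl_vec u * cl_vec u)"
    by (simp add: reflection_def linear_diff[OF linear_cl_vec] linear_scale[OF linear_cl_vec]
        algebra_simps)
  also have "\<dots> = cl_vec v * cl_vec u + (2 * (u \<bullet> v)) *\<^sub>R 1"
    by (simp add: cl_vec_unit_square[OF assms])
  also have "\<dots> = - (cl_vec u * cl_vec v)"
    using cl_vec_clifford[of u v] by (simp add: eq_neg_iff_add_eq_0 algebra_simps)
  finally show ?thesis by simp
qed

lemma vec_prod_covers:
  assumes "\<forall>u\<in>set us. norm u = 1"
  shows "vec_prod us * cl_vec v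
    = (- 1) ^ length us *\<^sub>R (cl_vec (foldr reflection us v) * vec_prod us)"
  using assms
proof (induction us)
  case (Cons u us)
  have "vec_prod (u # us) * cl_vec v = cl_vec u * (vec_prod us * cl_vec v)"
    by (simp add: mult.assoc)
  also have "\<dots> = (- 1) ^ length us *\<^sub>R (cl_vec u * cl_vec (foldr reflection us v) * vec_prod us)"
    using Cons by (simp add: mult.assoc)
  also have "cl_vec u * cl_vec (foldr reflection us v)
      = - (cl_vec (foldr reflection (u # us) v) * cl_vec u)"
    using Cons.prems by (simp add: cl_vec_reflection)
  finally show ?case by (simp add: mult.assoc)
qed simp

lemma cl_spin_covers:
  fixes x :: "'n::finite cl"
  assumes "x \<in> cl_spin"
  obtains \<phi> where "\<phi> \<in> special_orthogonal" "\<And>v. x * cl_vec v = cl_vec (\<phi> v) * x"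
proof -
  from assms obtain us where us: "\<forall>u\<in>set us. norm u = 1" "even (length us)" "x = vec_prod us"
    unfolding cl_spin_iff by blast
  show ?thesis
  proof
    show "foldr reflection us \<in> special_orthogonal"
      using foldr_reflection[OF us(1)] us(2) by (simp add: special_orthogonal_def)
    show "x * cl_vec v = cl_vec (foldr reflection us v) * x" for v
      using vec_prod_covers[OF us(1), of v] us(2) unfolding us(3) by simp
  qed
qed

lemma special_orthogonal_lift:
  fixes \<phi> :: "real ^ 'n::finite \<Rightarrow> real ^ 'n"
  assumes "\<phi> \<in> special_orthogonal"
  obtains x where "x \<in> cl_spin" "\<And>v. x * cl_vec v = cl_vec (\<phi> v) * x"
proof -
  have \<phi>: "orthogonal_transformation \<phi>" "det (matrix \<phi>) = 1"
    using assms by (auto simp: special_orthogonal_def)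
  from cartan_dieudonne[OF \<phi>(1)] obtain us
    where us: "\<forall>u\<in>set us. norm u = 1" "\<phi> = foldr reflection us" by blast
  have "even (length us)"
    using foldr_reflection(2)[OF us(1)] \<phi>(2) us(2)
    by (metis neg_one_odd_power one_neq_neg_one)
  show ?thesis
  proof
    show "vec_prod us \<in> cl_spin"
      using us(1) \<open>even (length us)\<close> unfolding cl_spin_iff by blast
    show "vec_prod us * cl_vec v = cl_vec (\<phi> v) * vec_prod us" for v
      using vec_prod_covers[OF us(1), of v] \<open>even (length us)\<close> us(2) by simp
  qed
qed


section \<open>The spin group acting on a Clifford module\<close>

text \<open>
  A unit vector acts by a map that is skew-adjoint and squares to \<open>- 1\<close>, hence by an isometry.
\<close>

lemma act_spin_linear_isometry:
  assumes M: "left_cl_module act" and g: "spin_metric act g" and x: "x \<in> cl_spin"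
  shows "linear_isometry g (act x)"
proof -
  note ms = cl_module_simps[OF M]
  have unit: "g (act (cl_vec u) s) (act (cl_vec u) t) = g s t" if "norm u = 1" for u s t
  proof -
    have "bilinear g" using g by (simp add: spin_metric_def real_inner_product_def)
    have "g (act (cl_vec u) s) (act (cl_vec u) t) = - g s (act (cl_vec u) (act (cl_vec u) t))"
      using g by (simp add: spin_metric_def skew_adjoint_def clifford_map_def)
    also have "\<dots> = g s t"
      by (simp add: ms(2)[symmetric] cl_vec_unit_square[OF that] ms(1,7)
          bilinear_rneg[OF \<open>bilinear g\<close>])
    finally show ?thesis .
  qed
  have "g (act (vec_prod us) s) (act (vec_prod us) t) = g s t" if "\<forall>u\<in>set us. norm u = 1" for us s t
    using that by (induction us) (simp_all add: ms unit)
  with x show ?thesis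
    by (auto simp: linear_isometry_def cl_spin_iff ms)
qed

lemma act_even_right_linear:
  assumes M: "left_cl_module act" and x: "x \<in> cl_even"
  shows "right_linear_over (KK0 act) (act x)"
  using x cl_module_simps[OF M]
  by (auto simp: right_linear_over_def right_act_def KK0_def cl_commutant_def)

lemma act_clifford_covers:
  assumes M: "left_cl_module act" and "\<And>v. x * cl_vec v = cl_vec (\<phi> v) * x"
  shows "clifford_covers act (act x) \<phi>"
  by (simp add: clifford_covers_def clifford_map_def assms flip: cl_module_simps(2)[OF M])

lemma cl_vec_act_inj:
  fixes act :: "'n::finite cl \<Rightarrow> 's::real_vector \<Rightarrow> 's"
  assumes M: "left_cl_module act" and s: "s \<noteq> 0" and eq: "act (cl_vec v) s = act (cl_vec w) s"
  shows "v = w"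
proof -
  note ms = cl_module_simps[OF M]
  have "act (cl_vec (v - w)) s = 0"
    using eq by (simp add: linear_diff[OF linear_cl_vec] ms)
  then have "act (cl_vec (v - w) * cl_vec (v - w)) s = 0" by (simp add: ms)
  then have "((v - w) \<bullet> (v - w)) *\<^sub>R s = 0"
    by (simp add: cl_vec_square ms)
  with s show ?thesis by simp
qed

text \<open>
  One vector \<open>s\<close> that \<open>\<Phi>\<close> does not kill determines \<open>\<phi>\<close>, as \<open>c(w)\<^sup>2 = - |w|\<^sup>2\<close> makes
  \<open>w \<mapsto> c(w) \<Phi>(s)\<close> injective.
\<close>

lemma clifford_covers_unique:
  assumes M: "left_cl_module act" and s: "\<Phi> s \<noteq> 0"
    and "clifford_covers act \<Phi> \<phi>" "clifford_covers act \<Phi> \<psi>"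
  shows "\<phi> = \<psi>"
proof
  fix v
  have "act (cl_vec (\<phi> v)) (\<Phi> s) = act (cl_vec (\<psi> v)) (\<Phi> s)"
    using assms(3,4) by (metis clifford_covers_def clifford_map_def)
  then show "\<phi> v = \<psi> v" by (rule cl_vec_act_inj[OF M s])
qed

lemma linear_isometry_nonzero:
  assumes g: "spin_metric act g" and \<Phi>: "linear_isometry g \<Phi>" and s: "s \<noteq> 0"
  shows "\<Phi> s \<noteq> 0"
proof -
  have "bilinear g" "g s s > 0"
    using g s by (auto simp: spin_metric_def real_inner_product_def)
  moreover have "g (\<Phi> s) (\<Phi> s) = g s s" using \<Phi> by (simp add: linear_isometry_def)
  ultimately show ?thesis by (auto simp: bilinear_lzero)
qed

lemma act_spin_faithful:
  fixes act :: "'n::finite cl \<Rightarrow> 's::real_vector \<Rightarrow> 's"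
  assumes M: "left_cl_module act" and nontriv: "\<exists>s::'s. s \<noteq> 0"
  shows "inj_on act cl_spin"
proof (rule inj_onI)
  fix x y :: "'n cl"
  note ms = cl_module_simps[OF M]
  assume x: "x \<in> cl_spin" and y: "y \<in> cl_spin" and eq: "act x = act y"
  obtain s :: 's where s: "s \<noteq> 0" using nontriv by blast
  obtain y' where y': "y' \<in> cl_spin" "y * y' = 1" "y' * y = 1"
    using cl_spin_inverse[OF y] by blast
  define z where "z = y' * x"
  have z: "z \<in> cl_spin" unfolding z_def by (rule cl_spin_mult[OF y'(1) x])
  have act_z: "act z t = t" for t
  proof -
    have "act z t = act (y' * y) t" by (simp add: z_def ms(2) eq)
    then show ?thesis by (simp add: y'(3) ms(1))
  qed
  obtain \<phi> where \<phi>: "\<And>v. z * cl_vec v = cl_vec (\<phi> v) * z"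
    using cl_spin_covers[OF z] by blast
  have "\<phi> v = v" for v
  proof (rule cl_vec_act_inj[OF M s])
    have "act (z * cl_vec v) s = act (cl_vec (\<phi> v) * z) s" by (simp add: \<phi>)
    then show "act (cl_vec (\<phi> v)) s = act (cl_vec v) s" by (simp add: ms(2) act_z)
  qed
  with \<phi> have "z * cl_vec v = cl_vec v * z" for v by simp
  moreover have "z \<in> cl_even" using z by (simp add: cl_spin_def)
  ultimately obtain c where c: "z = c *\<^sub>R 1" using even_central_imp_scalar by blast
  have "c *\<^sub>R s = s" using act_z[of s] by (simp add: c ms)
  then have "c = 1" using s by (metis scaleR_cancel_right scaleR_one)
  then have "y' * x = 1" using c by (simp add: z_def)
  have "x = (y * y') * x" using y' by simp
  also have "\<dots> = y" using \<open>y' * x = 1\<close> by (simp add: mult.assoc)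
  finally show "x = y" .
qed

lemma spin_transformation_from_spin:
  fixes act :: "'n::finite cl \<Rightarrow> 's::real_vector \<Rightarrow> 's"
  assumes M: "left_cl_module act" and nontriv: "\<exists>s::'s. s \<noteq> 0" and g: "spin_metric act g"
    and iso: "linear_isometry g \<Phi>" and K0: "right_linear_over (KK0 act) \<Phi>"
    and \<phi>: "\<phi> \<in> special_orthogonal" "clifford_covers act \<Phi> \<phi>"
  shows "\<exists>x\<in>cl_spin. \<Phi> = act x"
proof -
  note ms = cl_module_simps[OF M]
  obtain x where x: "x \<in> cl_spin" "\<And>v. x * cl_vec v = cl_vec (\<phi> v) * x"
    using special_orthogonal_lift[OF \<phi>(1)] by blast
  obtain y where y: "y \<in> cl_spin" "x * y = 1" "y * x = 1"
    using cl_spin_inverse[OF x(1)] by blast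
  have yx: "y * cl_vec (\<phi> v) = cl_vec v * y" for v
  proof -
    have "y * cl_vec (\<phi> v) = y * (cl_vec (\<phi> v) * x) * y"
      using y(2) by (simp add: mult.assoc)
    also have "\<dots> = (y * x) * cl_vec v * y" by (simp add: x(2)[symmetric] mult.assoc)
    finally show ?thesis using y(3) by simp
  qed
  define \<Psi> where "\<Psi> s = act y (\<Phi> s)" for s
  have \<Phi>\<Psi>: "\<Phi> s = act x (\<Psi> s)" for s
    using y(2) by (simp add: \<Psi>_def ms(1) flip: ms(2))
  have "linear \<Phi>" using iso by (simp add: linear_isometry_def)
  then have lin: "linear \<Psi>"
    unfolding \<Psi>_def by (intro linearI) (simp_all add: ms linear_add linear_scale)
  have vec: "\<Psi> (act (cl_vec v) s) = act (cl_vec v) (\<Psi> s)" for v s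
    using \<phi>(2) unfolding clifford_covers_def clifford_map_def \<Psi>_def
    by (simp add: yx flip: ms(2))
  have comm: "\<Psi> (a s) = a (\<Psi> s)" if "a \<in> KK0 act" for a s
    using that K0 y(1)
    by (simp add: right_linear_over_def right_act_def \<Psi>_def KK0_def cl_commutant_def cl_spin_def)
  obtain c where c: "\<And>s. \<Psi> s = c *\<^sub>R s"
    using commutant_scalar[OF M lin vec comm] by blast
  obtain s :: 's where s: "s \<noteq> 0" using nontriv by blast
  have bil: "bilinear g" and pos: "g s s > 0"
    using g s by (auto simp: spin_metric_def real_inner_product_def)
  have "g (\<Psi> s) (\<Psi> s) = g s s"
    using iso act_spin_linear_isometry[OF M g y(1)] by (simp add: linear_isometry_def \<Psi>_def)
  then have "c * c = 1"
    using pos by (simp add: c bilinear_lmul[OF bil] bilinear_rmul[OF bil])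
  then have "c = 1 \<or> c = - 1" by algebra
  moreover have "\<Phi> = act (c *\<^sub>R x)"
    by (auto simp: fun_eq_iff \<Phi>\<Psi> c ms)
  moreover have "- x \<in> cl_spin"
    using cl_spin_mult[OF minus_one_in_cl_spin x(1)] by simp
  ultimately show ?thesis using x(1) by auto
qed

theorem mainTheorem4:
  fixes act :: "'n::finite cl \<Rightarrow> 's::real_vector \<Rightarrow> 's"
    and g :: "'s \<Rightarrow> 's \<Rightarrow> real"
  assumes "irreducible_cl_module act"
    and "spin_metric act g"
  shows "(\<forall>\<Phi>. linear_isometry g \<Phi> \<and> right_linear_over (KK0 act) \<Phi> \<and>
              (\<exists>\<phi>\<in>special_orthogonal. clifford_covers act \<Phi> \<phi>)
            \<longrightarrow> (\<exists>x\<in>cl_spin. \<Phi> = act x)) \<and>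
         (\<forall>x\<in>cl_spin. linear_isometry g (act x) \<and> right_linear_over (KK0 act) (act x) \<and>
              (\<exists>\<phi>\<in>special_orthogonal. clifford_covers act (act x) \<phi>)) \<and>
         bij_betw act cl_spin (P_Spin act g)"
proof -
  have M: "left_cl_module act" and nontriv: "\<exists>s::'s. s \<noteq> 0"
    using assms(1) by (auto simp: irreducible_cl_module_def)
  have forward: "\<exists>x\<in>cl_spin. \<Phi> = act x"
    if "linear_isometry g \<Phi>" "right_linear_over (KK0 act) \<Phi>"
      "\<exists>\<phi>\<in>special_orthogonal. clifford_covers act \<Phi> \<phi>" for \<Phi>
    using that spin_transformation_from_spin[OF M nontriv assms(2)] by blast
  have backward: "linear_isometry g (act x) \<and> right_linear_over (KK0 act) (act x) \<and>
      (\<exists>\<phi>\<in>special_orthogonal. clifford_covers act (act x) \<phi>)" if x: "x \<in> cl_spin" for x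
  proof (intro conjI)
    show "linear_isometry g (act x)"
      by (rule act_spin_linear_isometry[OF M assms(2) x])
    show "right_linear_over (KK0 act) (act x)"
      using x by (intro act_even_right_linear[OF M]) (simp add: cl_spin_def)
    show "\<exists>\<phi>\<in>special_orthogonal. clifford_covers act (act x) \<phi>"
      using cl_spin_covers[OF x] act_clifford_covers[OF M] by metis
  qed
  obtain s :: 's where s: "s \<noteq> 0" using nontriv by blast
  have unique: "\<phi> = \<psi>" if "linear_isometry g \<Phi>" "clifford_covers act \<Phi> \<phi>" "clifford_covers act \<Phi> \<psi>"
    for \<Phi> \<phi> \<psi>
    using clifford_covers_unique[OF M linear_isometry_nonzero[OF assms(2) that(1) s] that(2,3)] .
  have "act ` cl_spin = P_Spin act g"
  proof
    show "act ` cl_spin \<subseteq> P_Spin act g"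
      using backward unique unfolding P_Spin_def by blast
    show "P_Spin act g \<subseteq> act ` cl_spin"
      using forward unfolding P_Spin_def by blast
  qed
  then have "bij_betw act cl_spin (P_Spin act g)"
    using act_spin_faithful[OF M nontriv] by (simp add: bij_betw_def)
  with forward backward show ?thesis by blast
qed

end
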